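(* Let $k\ge 2$ and $n\ge 1$ be integers. A $k^{th}$ order slant Hankel operator of level $n$ cannot be isometric; that is, for every $\phi\in L^\infty(\mathbb{T}^n)$, the operator $\mathcal{S}_\phi^{k,n}$ on $L^2(\mathbb{T}^n)$ is not an isometry.
   Context: $\mathbb{T}^n$ is the $n$-torus with normalized Haar measure; $e_m(z)=z^m=z_1^{m_1}\cdots z_n^{m_n}$ for $m\in\mathbb{Z}^n$, an orthonormal basis of $L^2(\mathbb{T}^n)$. For $m\in\mathbb{Z}^n$, $k\mid m$ means $k$ divides every component of $m$. Let $\mathcal{V}_k^n$ be the bounded linear operator on $L^2(\mathbb{T}^n)$ with $\mathcal{V}_k^n e_m=e_{-m/k}$ if $k\mid m$ and $\mathcal{V}_k^n e_m=0$ otherwise. For $\phi\in L^\infty(\mathbb{T}^n)$, $M_\phi$ is multiplication by $\phi$ and $\mathcal{S}_\phi^{k,n}=\mathcal{V}_k^nM_\phi$. *)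

theory Defs
  imports "HOL-Probability.Probability"
begin

(* Normalized arc length, i.e. the normalized Haar measure of the unit circle;
   the product of these is the normalized Haar measure of the torus T^n, n = CARD('n). *)
definition circle :: "complex measure" where
  "circle = distr (uniform_measure lborel {0..<2 * pi}) (restrict_space borel (sphere 0 1)) cis"

definition torus :: "('n::finite \<Rightarrow> complex) measure" where
  "torus = PiM UNIV (\<lambda>_. circle)"

lemma space_circle: "space circle = sphere 0 1"
  by (simp add: circle_def space_restrict_space)

lemma sets_circle: "sets circle = sets (restrict_space borel (sphere 0 1))"
  by (simp add: circle_def)

lemma prob_space_circle: "prob_space circle"
proof -
  have "prob_space (uniform_measure lborel {0..<2 * pi})"
    by (rule prob_space_uniform_measure) (auto simp: emeasure_lborel_Ico)
  moreover have "cis \<in> uniform_measure lborel {0..<2 * pi} \<rightarrow>\<^sub>M restrict_space borel (sphere 0 1)"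
  proof (rule measurable_restrict_space2)
    have "cis \<in> borel_measurable borel"
      by (intro borel_measurable_continuous_onI continuous_intros)
    then show "cis \<in> borel_measurable (uniform_measure lborel {0..<2 * pi})"
      by (simp cong: measurable_cong_sets)
  qed auto
  ultimately show ?thesis
    unfolding circle_def by (rule prob_space.prob_space_distr)
qed

interpretation torus: prob_space "torus :: ('n::finite \<Rightarrow> complex) measure"
  unfolding torus_def by (intro prob_space_PiM prob_space_circle)

lemma space_torus: "space torus = {z. \<forall>i. norm (z i) = 1}"
  by (auto simp: torus_def space_PiM space_circle PiE_def Pi_def extensional_def)

definition square_integrable :: "(('n::finite \<Rightarrow> complex) \<Rightarrow> complex) \<Rightarrow> bool" where
  "square_integrable f \<longleftrightarrow>
     f \<in> borel_measurable torus \<and> integrable torus (\<lambda>z. (norm (f z))\<^sup>2)"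

definition l2_norm :: "(('n::finite \<Rightarrow> complex) \<Rightarrow> complex) \<Rightarrow> real" where
  "l2_norm f = sqrt (\<integral>z. (norm (f z))\<^sup>2 \<partial>torus)"

definition l2_eq ::
    "(('n::finite \<Rightarrow> complex) \<Rightarrow> complex) \<Rightarrow> (('n \<Rightarrow> complex) \<Rightarrow> complex) \<Rightarrow> bool" where
  "l2_eq f g \<longleftrightarrow>
     square_integrable f \<and> square_integrable g \<and> (AE z in torus. f z = g z)"

lemma square_integrable_zero: "square_integrable (\<lambda>_. 0)"
  by (simp add: square_integrable_def)

lemma square_integrable_bounded_mult:
  assumes "\<phi> \<in> borel_measurable torus" "AE z in torus. norm (\<phi> z) \<le> B" "square_integrable f"
  shows "square_integrable (\<lambda>z. \<phi> z * f z)"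
proof -
  have [measurable]: "\<phi> \<in> borel_measurable torus" "f \<in> borel_measurable torus"
    using assms by (auto simp: square_integrable_def)
  have "integrable torus (\<lambda>z. (norm (\<phi> z * f z))\<^sup>2)"
  proof (rule Bochner_Integration.integrable_bound)
    show "integrable torus (\<lambda>z. B\<^sup>2 * (norm (f z))\<^sup>2)"
      using assms(3) by (auto simp: square_integrable_def)
    show "AE z in torus. norm ((norm (\<phi> z * f z))\<^sup>2) \<le> norm (B\<^sup>2 * (norm (f z))\<^sup>2)"
      using assms(2) by eventually_elim
        (auto simp: norm_mult power_mult_distrib intro!: mult_right_mono power_mono)
  qed measurable
  then show ?thesis by (simp add: square_integrable_def)
qed

lemma square_integrable_scale:
  assumes "square_integrable f"
  shows "square_integrable (\<lambda>z. c * f z)"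
  using square_integrable_bounded_mult[of "\<lambda>_. c" "norm c" f] assms by simp

lemma square_integrable_add:
  assumes "square_integrable f" "square_integrable g"
  shows "square_integrable (\<lambda>z. f z + g z)"
proof -
  have [measurable]: "f \<in> borel_measurable torus" "g \<in> borel_measurable torus"
    using assms by (auto simp: square_integrable_def)
  have "(norm (x + y))\<^sup>2 \<le> 2 * (norm x)\<^sup>2 + 2 * (norm y)\<^sup>2" for x y :: complex
  proof -
    have "(norm (x + y))\<^sup>2 \<le> (norm x + norm y)\<^sup>2"
      by (intro power_mono norm_triangle_ineq) simp
    also have "\<dots> \<le> 2 * (norm x)\<^sup>2 + 2 * (norm y)\<^sup>2"
      using zero_le_power2[of "norm x - norm y"] by (simp add: power2_eq_square algebra_simps)
    finally show ?thesis .
  qed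
  then have *: "norm ((norm (f z + g z))\<^sup>2) \<le> norm (2 * (norm (f z))\<^sup>2 + 2 * (norm (g z))\<^sup>2)" for z
    by simp
  have "integrable torus (\<lambda>z. (norm (f z + g z))\<^sup>2)"
  proof (rule Bochner_Integration.integrable_bound)
    show "integrable torus (\<lambda>z. 2 * (norm (f z))\<^sup>2 + 2 * (norm (g z))\<^sup>2)"
      using assms by (simp add: square_integrable_def)
    show "AE z in torus. norm ((norm (f z + g z))\<^sup>2) \<le>
        norm (2 * (norm (f z))\<^sup>2 + 2 * (norm (g z))\<^sup>2)"
      using * by (intro AE_I2)
  qed measurable
  then show ?thesis by (simp add: square_integrable_def)
qed

lemma l2_norm_nonneg: "0 \<le> l2_norm f"
  by (simp add: l2_norm_def)

lemma l2_norm_power2: "(l2_norm f)\<^sup>2 = (\<integral>z. (norm (f z))\<^sup>2 \<partial>torus)"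
  by (simp add: l2_norm_def)

lemma l2_norm_eq_0_iff:
  assumes "square_integrable f"
  shows "l2_norm f = 0 \<longleftrightarrow> (AE z in torus. f z = 0)"
  using assms integral_nonneg_eq_0_iff_AE[of torus "\<lambda>z. (norm (f z))\<^sup>2"]
  by (simp add: l2_norm_def square_integrable_def)

lemma l2_norm_cong_AE:
  assumes "square_integrable f" "square_integrable g" "AE z in torus. f z = g z"
  shows "l2_norm f = l2_norm g"
proof -
  have [measurable]: "f \<in> borel_measurable torus" "g \<in> borel_measurable torus"
    using assms by (auto simp: square_integrable_def)
  have "(\<integral>z. (norm (f z))\<^sup>2 \<partial>torus) = (\<integral>z. (norm (g z))\<^sup>2 \<partial>torus)"
  proof (rule integral_cong_AE)
    show "AE z in torus. (norm (f z))\<^sup>2 = (norm (g z))\<^sup>2"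
      using assms(3) by eventually_elim simp
  qed measurable
  then show ?thesis by (simp add: l2_norm_def)
qed

lemma l2_norm_scale: "l2_norm (\<lambda>z. c * f z) = norm c * l2_norm f"
  by (simp add: l2_norm_def norm_mult power_mult_distrib real_sqrt_mult)

lemma l2_norm_triangle:
  assumes f: "square_integrable f" and g: "square_integrable g"
  shows "l2_norm (\<lambda>z. f z + g z) \<le> l2_norm f + l2_norm g"
proof -
  define a b where "a = l2_norm f" and "b = l2_norm g"
  have nn: "a \<ge> 0" "b \<ge> 0" by (simp_all add: a_def b_def l2_norm_nonneg)
  consider "a = 0" | "b = 0" | "a > 0" "b > 0" using nn by fastforce
  then show ?thesis
  proof cases
    case 1
    then have "AE z in torus. f z = 0" using f by (simp add: a_def l2_norm_eq_0_iff)
    then have "AE z in torus. f z + g z = g z" by eventually_elim simp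
    from l2_norm_cong_AE[OF square_integrable_add[OF f g] g this] show ?thesis
      by (simp add: l2_norm_nonneg)
  next
    case 2
    then have "AE z in torus. g z = 0" using g by (simp add: b_def l2_norm_eq_0_iff)
    then have "AE z in torus. f z + g z = f z" by eventually_elim simp
    from l2_norm_cong_AE[OF square_integrable_add[OF f g] f this] show ?thesis
      by (simp add: l2_norm_nonneg)
  next
    case 3
    have *: "(norm (x + y))\<^sup>2 \<le> (a + b) * ((norm x)\<^sup>2 / a + (norm y)\<^sup>2 / b)" for x y :: complex
    proof -
      have "(norm (x + y))\<^sup>2 \<le> (norm x + norm y)\<^sup>2"
        by (intro power_mono norm_triangle_ineq) simp
      also have "\<dots> \<le> (a + b) * ((norm x)\<^sup>2 / a + (norm y)\<^sup>2 / b)"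
      proof -
        have "(a + b) * ((norm x)\<^sup>2 / a + (norm y)\<^sup>2 / b) - (norm x + norm y)\<^sup>2 =
              (b * norm x - a * norm y)\<^sup>2 / (a * b)"
          using 3 by (simp add: field_simps power2_eq_square)
        also have "\<dots> \<ge> 0" using 3 by simp
        finally show ?thesis by simp
      qed
      finally show ?thesis .
    qed
    have "(l2_norm (\<lambda>z. f z + g z))\<^sup>2 \<le>
        (\<integral>z. (a + b) * ((norm (f z))\<^sup>2 / a + (norm (g z))\<^sup>2 / b) \<partial>torus)"
      unfolding l2_norm_power2
      by (rule integral_mono)
         (use f g square_integrable_add[OF f g] * in \<open>simp_all add: square_integrable_def\<close>)
    also have "\<dots> = (a + b) * (a\<^sup>2 / a + b\<^sup>2 / b)"
      using f g by (simp add: a_def b_def l2_norm_power2 square_integrable_def)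
    also have "\<dots> = (a + b)\<^sup>2"
      using 3 by (simp add: power2_eq_square)
    finally show ?thesis
      unfolding a_def b_def by (rule power2_le_imp_le) (simp add: l2_norm_nonneg)
  qed
qed

lemma l2_eq_add:
  assumes "l2_eq f f'" "l2_eq g g'"
  shows "l2_eq (\<lambda>z. f z + g z) (\<lambda>z. f' z + g' z)"
proof -
  from assms have "AE z in torus. f z = f' z" "AE z in torus. g z = g' z"
    by (simp_all add: l2_eq_def)
  then have "AE z in torus. f z + g z = f' z + g' z" by eventually_elim simp
  with assms show ?thesis by (simp add: l2_eq_def square_integrable_add)
qed

(* L^2(T^n): square-integrable functions modulo equality almost everywhere.  The representatives
   are defined on all of 'n \<Rightarrow> complex, but their values off the torus play no role. *)
quotient_type (overloaded) 'n l2 = "('n::finite \<Rightarrow> complex) \<Rightarrow> complex" / partial: l2_eq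
  morphisms rep_l2 abs_l2
proof (rule part_equivpI)
  show "\<exists>f. l2_eq f f"
    using square_integrable_zero by (auto simp: l2_eq_def)
  show "symp l2_eq"
    by (auto simp: symp_def l2_eq_def elim: eventually_mono)
  show "transp l2_eq"
  proof (rule transpI)
    fix f g h
    assume fg: "l2_eq f g" and gh: "l2_eq g h"
    then have "AE z in torus. f z = g z" "AE z in torus. g z = h z"
      by (simp_all add: l2_eq_def)
    then have "AE z in torus. f z = h z" by eventually_elim simp
    with fg gh show "l2_eq f h" by (simp add: l2_eq_def)
  qed
qed

lift_definition scaleC :: "complex \<Rightarrow> 'n::finite l2 \<Rightarrow> 'n l2" (infixr \<open>*\<^sub>C\<close> 75)
  is "\<lambda>c f z. c * f z"
  by (auto simp: l2_eq_def square_integrable_scale elim: eventually_mono)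

instantiation l2 :: (finite) real_normed_vector
begin

lift_definition zero_l2 :: "'a l2" is "\<lambda>_. 0"
  by (simp add: l2_eq_def square_integrable_zero)

lift_definition plus_l2 :: "'a l2 \<Rightarrow> 'a l2 \<Rightarrow> 'a l2" is "\<lambda>f g z. f z + g z"
  by (rule l2_eq_add)

lift_definition uminus_l2 :: "'a l2 \<Rightarrow> 'a l2" is "\<lambda>f z. - f z"
  using square_integrable_scale[of _ "- 1"]
  by (auto simp: l2_eq_def elim: eventually_mono)

lift_definition norm_l2 :: "'a l2 \<Rightarrow> real" is l2_norm
  by (auto simp: l2_eq_def intro: l2_norm_cong_AE)

definition "scaleR_l2 r (f :: 'a l2) = complex_of_real r *\<^sub>C f"
definition "minus_l2 (f :: 'a l2) g = f + - g"
definition "dist_l2 (f :: 'a l2) g = norm (f - g)"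
definition "sgn_l2 (f :: 'a l2) = scaleR (inverse (norm f)) f"
definition [code del]:
  "(uniformity :: ('a l2 \<times> 'a l2) filter) = (INF e\<in>{0<..}. principal {(x, y). dist x y < e})"
definition [code del]:
  "open (U :: 'a l2 set) \<longleftrightarrow> (\<forall>x\<in>U. eventually (\<lambda>(x', y). x' = x \<longrightarrow> y \<in> U) uniformity)"

instance
proof
  fix f g h :: "'a l2" and r s :: real
  show "f + g + h = f + (g + h)"
    by transfer (auto simp: l2_eq_def square_integrable_add add.assoc)
  show "f + g = g + f"
    by transfer (auto simp: l2_eq_def square_integrable_add add.commute)
  show "0 + f = f"
    by transfer (auto simp: l2_eq_def)
  show "- f + f = 0"
    by transfer (auto simp: l2_eq_def square_integrable_zero)
  show "f - g = f + - g" by (simp add: minus_l2_def)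
  show "r *\<^sub>R (f + g) = r *\<^sub>R f + r *\<^sub>R g"
    unfolding scaleR_l2_def by transfer
      (auto simp: l2_eq_def square_integrable_add square_integrable_scale distrib_left)
  show "(r + s) *\<^sub>R f = r *\<^sub>R f + s *\<^sub>R f"
    unfolding scaleR_l2_def by transfer
      (auto simp: l2_eq_def square_integrable_add square_integrable_scale distrib_right)
  show "r *\<^sub>R s *\<^sub>R f = (r * s) *\<^sub>R f"
    unfolding scaleR_l2_def by transfer
      (auto simp: l2_eq_def square_integrable_scale mult.assoc)
  show "1 *\<^sub>R f = f"
    unfolding scaleR_l2_def by transfer (auto simp: l2_eq_def)
  show "dist f g = norm (f - g)" by (simp add: dist_l2_def)
  show "sgn f = scaleR (inverse (norm f)) f" by (simp add: sgn_l2_def)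
  show "(uniformity :: ('a l2 \<times> 'a l2) filter) =
      (INF e\<in>{0<..}. principal {(x, y). dist x y < e})"
    by (simp add: uniformity_l2_def)
  show "open U \<longleftrightarrow> (\<forall>x\<in>U. eventually (\<lambda>(x', y). x' = x \<longrightarrow> y \<in> U) uniformity)"
    for U :: "'a l2 set"
    by (simp add: open_l2_def)
  show "norm f = 0 \<longleftrightarrow> f = 0"
    by transfer (auto simp: l2_eq_def l2_norm_eq_0_iff square_integrable_zero)
  show "norm (f + g) \<le> norm f + norm g"
    by transfer (auto simp: l2_eq_def l2_norm_triangle)
  show "norm (r *\<^sub>R f) = \<bar>r\<bar> * norm f"
    unfolding scaleR_l2_def by transfer (simp add: l2_norm_scale)
qed

end

definition monomial :: "('n::finite \<Rightarrow> int) \<Rightarrow> ('n \<Rightarrow> complex) \<Rightarrow> complex" where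
  "monomial m z = (\<Prod>i\<in>UNIV. z i powi m i)"

lemma measurable_coordinate: "(\<lambda>z. z i) \<in> borel_measurable (torus :: ('n::finite \<Rightarrow> complex) measure)"
proof -
  have "(\<lambda>z. z i) \<in> torus \<rightarrow>\<^sub>M circle"
    unfolding torus_def by (rule measurable_component_singleton) simp
  moreover have "(\<lambda>x. x) \<in> borel_measurable circle"
    unfolding measurable_cong_sets[OF sets_circle refl] by (rule measurable_restrict_space1) simp
  ultimately show ?thesis by (rule measurable_compose)
qed

lemma square_integrable_monomial: "square_integrable (monomial m)"
proof -
  have [measurable]: "(\<lambda>z :: 'a \<Rightarrow> complex. z i powi m i) \<in> borel_measurable torus" for i
    using measurable_coordinate[of i, measurable] unfolding power_int_def by (cases "m i \<ge> 0") simp_all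
  have [measurable]: "monomial m \<in> borel_measurable torus"
    unfolding monomial_def[abs_def] by measurable
  have "norm (monomial m z) = 1" if "z \<in> space torus" for z
    using that by (simp add: space_torus monomial_def norm_power_int flip: prod_norm)
  then have "integrable torus (\<lambda>z. (norm (monomial m z))\<^sup>2) \<longleftrightarrow>
      integrable torus (\<lambda>_ :: 'a \<Rightarrow> complex. 1 :: real)"
    by (intro Bochner_Integration.integrable_cong) auto
  then show ?thesis by (simp add: square_integrable_def)
qed

lift_definition basis_vec :: "('n::finite \<Rightarrow> int) \<Rightarrow> 'n l2" is monomial
  by (simp add: l2_eq_def square_integrable_monomial)

definition L_infty :: "(('n::finite \<Rightarrow> complex) \<Rightarrow> complex) set" where
  "L_infty = {\<phi> \<in> borel_measurable torus. \<exists>B. AE z in torus. norm (\<phi> z) \<le> B}"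

(* Meaningful for \<phi> in L_infty, where it does not depend on the representatives
   (mult_op_abs_l2 below). *)
definition mult_op :: "(('n::finite \<Rightarrow> complex) \<Rightarrow> complex) \<Rightarrow> 'n l2 \<Rightarrow> 'n l2" where
  "mult_op \<phi> f = abs_l2 (\<lambda>z. \<phi> z * rep_l2 f z)"

lemma mult_op_abs_l2:
  assumes "\<phi> \<in> L_infty" "square_integrable f"
  shows "mult_op \<phi> (abs_l2 f) = abs_l2 (\<lambda>z. \<phi> z * f z)"
proof -
  from assms(1) obtain B where B: "\<phi> \<in> borel_measurable torus" "AE z in torus. norm (\<phi> z) \<le> B"
    by (auto simp: L_infty_def)
  have "l2_eq (rep_l2 (abs_l2 f)) f"
    using assms(2) by (intro rep_abs_rsp_left[OF Quotient3_l2]) (simp add: l2_eq_def)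
  then have "l2_eq (\<lambda>z. \<phi> z * rep_l2 (abs_l2 f) z) (\<lambda>z. \<phi> z * f z)"
    by (auto simp: l2_eq_def intro: square_integrable_bounded_mult[OF B] elim: eventually_mono)
  then show ?thesis
    unfolding mult_op_def by (rule Quotient3_rel_abs[OF Quotient3_l2])
qed

definition bounded_clinear_op :: "('n::finite l2 \<Rightarrow> 'n l2) \<Rightarrow> bool" where
  "bounded_clinear_op T \<longleftrightarrow> bounded_linear T \<and> (\<forall>c f. T (c *\<^sub>C f) = c *\<^sub>C T f)"

(* Monomials span a dense subspace of L^2, so at most one operator satisfies this for given k;
   it is the "V_k" of the theory, (V_k f)(z) being the mean of f over all w with w_i^k = 1 / z_i. *)
definition is_V :: "nat \<Rightarrow> ('n::finite l2 \<Rightarrow> 'n l2) \<Rightarrow> bool" where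
  "is_V k V \<longleftrightarrow> bounded_clinear_op V \<and>
     (\<forall>m. V (basis_vec m) =
        (if \<forall>i. int k dvd m i then basis_vec (\<lambda>i. - (m i div int k)) else 0))"

definition slant_hankel ::
    "('n::finite l2 \<Rightarrow> 'n l2) \<Rightarrow> (('n \<Rightarrow> complex) \<Rightarrow> complex) \<Rightarrow> 'n l2 \<Rightarrow> 'n l2" where
  "slant_hankel V \<phi> = V \<circ> mult_op \<phi>"

definition isometric_op :: "('n::finite l2 \<Rightarrow> 'n l2) \<Rightarrow> bool" where
  "isometric_op T \<longleftrightarrow> (\<forall>f. norm (T f) = norm f)"

end

theory Submission
  imports Defs
begin

text \<open>
  Let c = exp (2 * pi * i / k) and let R be the rotation (R f) z = f (c z) in all coordinates.
  Monomials span a dense subspace of L^2, and V R agrees with V on them: R multiplies e_m by c to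
  the power of the sum of the m_i, which is 1 if k divides m, while V e_m = 0 otherwise.  Hence
  V R = V, so V kills all differences h - R h.  If V M_phi is injective, it follows that
  phi (c z) a z = phi (z / c) a (z / c) almost everywhere for all a in L^2.  Comparing a = 1 with
  a = z_i yields phi = 0, as c is not 1; so V M_phi is not even injective.
\<close>

section \<open>Density of the monomials\<close>

text \<open>The obstacle is that a difference h - R h need not be a multiple of \<phi>: the symbol
  may vanish on a set of positive measure, and where it does not vanish, dividing by it may lead out
  of L^2. Hence h is taken of the form \<phi>(z) \<phi>(c z) a(z). Its rotate by 1/c is \<phi>(z/c)
  \<phi>(z) a(z/c), so both terms carry the factor \<phi>(z), and the cofactors remain in L^2
  because \<phi> is bounded. The function a is free, and two choices suffice because 1 and z_i are
  eigenfunctions of the rotation with different eigenvalues. The condition k \<ge> 2 supplies a root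
  of unity other than 1. For k = 1 the operator V is unitary, and \<phi> = 1 gives an isometry.
  Since V is specified only by its values on the monomials, the identity V R = V is out of reach
  without their density and the continuity of R; the latter rests on the invariance of the measure
  under rotations.\<close>

lemma l2_eq_refl_iff: "l2_eq f f \<longleftrightarrow> square_integrable f"
  by (simp add: l2_eq_def)

lemma abs_l2_eqI:
  assumes "square_integrable f" "square_integrable g" "AE z in torus. f z = g z"
  shows "abs_l2 f = abs_l2 g"
  using assms by (intro Quotient3_rel_abs[OF Quotient3_l2]) (simp add: l2_eq_def)

lemma abs_l2_eq_0_iff:
  assumes "square_integrable f"
  shows "abs_l2 f = 0 \<longleftrightarrow> (AE z in torus. f z = 0)"
  using assms l2_norm_eq_0_iff[OF assms] norm_l2.abs_eq[of f] norm_eq_zero[of "abs_l2 f"]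
  by (simp add: l2_eq_refl_iff)

lemma abs_l2_add:
  assumes "square_integrable f" "square_integrable g"
  shows "abs_l2 (\<lambda>z. f z + g z) = abs_l2 f + abs_l2 g"
  using assms by (simp add: plus_l2.abs_eq l2_eq_refl_iff)

lemma abs_l2_scale:
  assumes "square_integrable f"
  shows "abs_l2 (\<lambda>z. c * f z) = c *\<^sub>C abs_l2 f"
  using assms by (simp add: scaleC.abs_eq l2_eq_refl_iff)

lemma square_integrable_diff:
  assumes "square_integrable f" "square_integrable g"
  shows "square_integrable (\<lambda>z. f z - g z)"
  using square_integrable_add[OF assms(1) square_integrable_scale[OF assms(2), of "-1"]] by simp

lemma abs_l2_diff:
  assumes "square_integrable f" "square_integrable g"
  shows "abs_l2 (\<lambda>z. f z - g z) = abs_l2 f - abs_l2 g"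
proof -
  have "abs_l2 (\<lambda>z. f z - g z) + abs_l2 g = abs_l2 f"
    using abs_l2_add[OF square_integrable_diff[OF assms] assms(2)] by simp
  then show ?thesis by (simp add: algebra_simps)
qed

lemma square_integrable_bounded:
  assumes "f \<in> borel_measurable torus" "\<And>z. z \<in> space torus \<Longrightarrow> norm (f z) \<le> B"
  shows "square_integrable f"
proof -
  have "square_integrable (\<lambda>_. 1)"
    by (simp add: square_integrable_def)
  from square_integrable_bounded_mult[OF assms(1) _ this, of B] assms(2) show ?thesis by simp
qed

lemma square_integrable_indicator:
  assumes "(indicator A :: _ \<Rightarrow> complex) \<in> borel_measurable torus"
  shows "square_integrable (indicator A)"
  using assms by (rule square_integrable_bounded[where B = 1]) (simp split: split_indicator)

text \<open>Dominated convergence for the squares: both functions are bounded by |w|, so |g_n - f|^2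
  \<le> 4 |w|^2. The bound is a square integrable function and not a constant, so that unbounded
  limits \<open>f\<close> are covered as well.\<close>

lemma tendsto_abs_l2:
  assumes g: "\<And>n :: nat. g n \<in> borel_measurable torus" and f: "f \<in> borel_measurable torus"
    and w: "square_integrable w"
    and le: "\<And>n z. z \<in> space torus \<Longrightarrow> norm (g n z) \<le> norm (w z)"
    and lim: "\<And>z. z \<in> space torus \<Longrightarrow> (\<lambda>n. g n z) \<longlonglongrightarrow> f z"
  shows "square_integrable (g n)" "square_integrable f" "(\<lambda>n. abs_l2 (g n)) \<longlonglongrightarrow> abs_l2 f"
proof -
  have lef: "norm (f z) \<le> norm (w z)" if "z \<in> space torus" for z
    using tendsto_norm[OF lim[OF that]] le[OF that] by (intro LIMSEQ_le_const2) auto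
  have sq: "square_integrable h"
    if "h \<in> borel_measurable torus" "\<And>z. z \<in> space torus \<Longrightarrow> norm (h z) \<le> norm (w z)"
    for h :: "('a \<Rightarrow> complex) \<Rightarrow> complex"
  proof -
    have "integrable torus (\<lambda>z. (norm (h z))\<^sup>2)"
    proof (rule Bochner_Integration.integrable_bound)
      show "integrable torus (\<lambda>z. (norm (w z))\<^sup>2)" using w by (simp add: square_integrable_def)
      show "(\<lambda>z. (norm (h z))\<^sup>2) \<in> borel_measurable torus" using that(1) by measurable
      show "AE z in torus. norm ((norm (h z))\<^sup>2) \<le> norm ((norm (w z))\<^sup>2)"
        using that(2) by (intro AE_I2) (simp add: power_mono)
    qed
    with that show ?thesis by (simp add: square_integrable_def)
  qed
  show gs: "square_integrable (g n)" for n using sq g le by blast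
  show fs: "square_integrable f" using sq f lef by blast
  have "(\<lambda>n. \<integral>z. (norm (g n z - f z))\<^sup>2 \<partial>torus) \<longlonglongrightarrow> (\<integral>z. 0 \<partial>(torus :: ('a \<Rightarrow> complex) measure))"
  proof (rule integral_dominated_convergence[where w = "\<lambda>z. 4 * (norm (w z))\<^sup>2"])
    show "integrable torus (\<lambda>z. 4 * (norm (w z))\<^sup>2)" using w by (simp add: square_integrable_def)
    show "AE z in torus. (\<lambda>n. (norm (g n z - f z))\<^sup>2) \<longlonglongrightarrow> 0"
    proof (rule AE_I2)
      fix z :: "'a \<Rightarrow> complex" assume "z \<in> space torus"
      from tendsto_power[OF tendsto_norm[OF tendsto_diff[OF lim[OF this] tendsto_const[of "f z"]]], of 2]
      show "(\<lambda>n. (norm (g n z - f z))\<^sup>2) \<longlonglongrightarrow> 0" by simp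
    qed
    show "AE z in torus. norm ((norm (g n z - f z))\<^sup>2) \<le> 4 * (norm (w z))\<^sup>2" for n
    proof (rule AE_I2)
      fix z :: "'a \<Rightarrow> complex" assume z: "z \<in> space torus"
      have "norm (g n z - f z) \<le> 2 * norm (w z)"
        using norm_triangle_ineq4[of "g n z" "f z"] le[OF z, of n] lef[OF z] by simp
      then have "(norm (g n z - f z))\<^sup>2 \<le> (2 * norm (w z))\<^sup>2" by (intro power_mono) auto
      then show "norm ((norm (g n z - f z))\<^sup>2) \<le> 4 * (norm (w z))\<^sup>2" by (simp add: power_mult_distrib)
    qed
  qed (use g f in measurable)
  then have "(\<lambda>n. l2_norm (\<lambda>z. g n z - f z)) \<longlonglongrightarrow> 0"
    unfolding l2_norm_def using tendsto_real_sqrt[of _ 0 sequentially] by simp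
  moreover have "norm (abs_l2 (g n) - abs_l2 f) = l2_norm (\<lambda>z. g n z - f z)" for n
    using norm_l2.abs_eq[of "\<lambda>z. g n z - f z"] square_integrable_diff[OF gs fs]
    by (simp add: abs_l2_diff[OF gs fs] l2_eq_refl_iff)
  ultimately show "(\<lambda>n. abs_l2 (g n)) \<longlonglongrightarrow> abs_l2 f"
    by (subst tendsto_dist_iff) (simp add: dist_norm)
qed

section \<open>The torus as a compact space and its Borel sets\<close>

lemma measurable_torus_borel: "(\<lambda>z. z) \<in> borel_measurable (torus :: ('n::finite \<Rightarrow> complex) measure)"
  by (intro measurable_coordinatewise_then_product measurable_coordinate)

lemma compact_torus: "compact (space (torus :: ('n::finite \<Rightarrow> complex) measure))"
proof -
  have "compactin (product_topology (\<lambda>_. euclidean) (UNIV :: 'n set)) (\<Pi>\<^sub>E _\<in>UNIV. sphere (0::complex) 1)"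
    by (simp add: compactin_PiE)
  moreover have "(\<Pi>\<^sub>E _\<in>UNIV. sphere (0::complex) 1) = space (torus :: ('n \<Rightarrow> complex) measure)"
    by (auto simp: space_torus PiE_def Pi_def extensional_def)
  ultimately show ?thesis by (simp add: euclidean_product_topology)
qed

text \<open>Coordinate projections are continuous, so the generators of the product sigma-algebra
  are traces of Borel sets. Together with \<open>measurable_torus_borel\<close> this identifies that
  sigma-algebra with the trace of the Borel sets, which are generated by closed sets and thus
  accessible from continuous functions.\<close>

lemma sets_torus_subset_borel:
  assumes "A \<in> sets (torus :: ('n::finite \<Rightarrow> complex) measure)"
  obtains B where "B \<in> sets borel" "A = space torus \<inter> B"
proof -
  let ?N = "restrict_space borel (space torus) :: ('n \<Rightarrow> complex) measure"
  have "sets torus \<subseteq> sets ?N"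
    unfolding torus_def
  proof (rule sets_PiM_in_sets)
    show "space (restrict_space borel (space (PiM UNIV (\<lambda>_::'n. circle)))) = (\<Pi>\<^sub>E i\<in>(UNIV::'n set). space circle)"
      by (simp add: space_restrict_space space_PiM)
    fix i :: 'n and A assume "A \<in> sets circle"
    then obtain C where C: "C \<in> sets borel" "A = sphere 0 1 \<inter> C"
      by (auto simp: sets_circle sets_restrict_space)
    let ?B = "(\<lambda>z::'n \<Rightarrow> complex. z i) -` C \<inter> space borel"
    have "?B \<in> sets borel"
      using C(1) by (intro measurable_sets[of _ borel borel] borel_measurable_continuous_onI continuous_intros) auto
    moreover have "{x \<in> space (restrict_space borel (space (PiM UNIV (\<lambda>_::'n. circle)))). x i \<in> A} = space (PiM UNIV (\<lambda>_::'n. circle)) \<inter> ?B"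
      using C(2) by (auto simp: space_restrict_space space_PiM space_circle)
    ultimately show "{x \<in> space (restrict_space borel (space (PiM UNIV (\<lambda>_::'n. circle)))). x i \<in> A} \<in>
        sets (restrict_space borel (space (PiM UNIV (\<lambda>_::'n. circle))))"
      by (auto simp: sets_restrict_space)
  qed
  with assms that show ?thesis by (auto simp: sets_restrict_space)
qed

section \<open>Trigonometric polynomials and the Stone-Weierstrass theorem\<close>

inductive_set trig_poly :: "(('n::finite \<Rightarrow> complex) \<Rightarrow> complex) set" where
  monomial: "monomial m \<in> trig_poly"
| add: "f \<in> trig_poly \<Longrightarrow> g \<in> trig_poly \<Longrightarrow> (\<lambda>z. f z + g z) \<in> trig_poly"
| scale: "f \<in> trig_poly \<Longrightarrow> (\<lambda>z. c * f z) \<in> trig_poly"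

lemma square_integrable_trig_poly: "p \<in> trig_poly \<Longrightarrow> square_integrable p"
  by (induction rule: trig_poly.induct)
    (auto intro: square_integrable_monomial square_integrable_add square_integrable_scale)

lemma monomial_mult:
  assumes "z \<in> space torus"
  shows "monomial m z * monomial m' z = monomial (\<lambda>i. m i + m' i) z"
proof -
  have "z i \<noteq> 0" for i using assms by (auto simp: space_torus dest: spec[of _ i])
  then show ?thesis by (simp add: monomial_def prod.distrib power_int_add)
qed

text \<open>Equality is claimed on the torus only: where a coordinate is 0, \<open>powi\<close> is
  not additive in the exponent, so a product of monomials need not be a monomial there.\<close>

lemma trig_poly_mult:
  assumes "p \<in> trig_poly" "q \<in> trig_poly"
  shows "\<exists>r\<in>trig_poly. \<forall>z\<in>space torus. p z * q z = r z"
  using assms(1)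
proof induction
  case (monomial m)
  show ?case using assms(2)
  proof induction
    case (monomial m')
    then show ?case using trig_poly.monomial monomial_mult by blast
  next
    case (add f g)
    then obtain r s where "r \<in> trig_poly" "s \<in> trig_poly"
      "\<forall>z\<in>space torus. monomial m z * f z = r z" "\<forall>z\<in>space torus. monomial m z * g z = s z" by blast
    then show ?case by (intro bexI[OF _ trig_poly.add[of r s]]) (auto simp: algebra_simps)
  next
    case (scale f c)
    then obtain r where "r \<in> trig_poly" "\<forall>z\<in>space torus. monomial m z * f z = r z" by blast
    then show ?case by (intro bexI[OF _ trig_poly.scale[of r c]]) (auto simp: algebra_simps)
  qed
next
  case (add f g)
  then obtain r s where "r \<in> trig_poly" "s \<in> trig_poly"
    "\<forall>z\<in>space torus. f z * q z = r z" "\<forall>z\<in>space torus. g z * q z = s z" by blast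
  then show ?case by (intro bexI[OF _ trig_poly.add[of r s]]) (auto simp: algebra_simps)
next
  case (scale f c)
  then obtain r where "r \<in> trig_poly" "\<forall>z\<in>space torus. f z * q z = r z" by blast
  then show ?case by (intro bexI[OF _ trig_poly.scale[of r c]]) (auto simp: algebra_simps)
qed

lemma monomial_single:
  "monomial (\<lambda>j. if j = i then e else 0) z = z i powi e"
proof -
  have "monomial (\<lambda>j. if j = i then e else 0) z = (\<Prod>j\<in>UNIV. if j = i then z j powi e else 1)"
    unfolding monomial_def by (intro prod.cong) auto
  then show ?thesis by simp
qed

lemma trig_poly_coordinate: "(\<lambda>z. z i) \<in> trig_poly" "(\<lambda>z. inverse (z i)) \<in> trig_poly"
  using trig_poly.monomial[of "\<lambda>j. if j = i then 1 else 0"]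
    trig_poly.monomial[of "\<lambda>j. if j = i then -1 else 0"]
  by (simp_all add: monomial_single[abs_def] power_int_minus)

lemma trig_poly_const: "(\<lambda>_. c) \<in> trig_poly"
  using trig_poly.scale[OF trig_poly.monomial[of "\<lambda>_. 0"], of c] by (simp add: monomial_def)

text \<open>Stone-Weierstrass is applied in its real form, hence the real-valued functions that
  agree on the torus with a complex trigonometric polynomial.\<close>

definition real_trig_poly :: "(('n::finite \<Rightarrow> complex) \<Rightarrow> real) set" where
  "real_trig_poly = {g. continuous_on (space torus) g \<and>
     (\<exists>p\<in>trig_poly. \<forall>z\<in>space torus. complex_of_real (g z) = p z)}"

lemma real_trig_polyI:
  assumes "continuous_on (space torus) g" "p \<in> trig_poly"
    "\<And>z. z \<in> space torus \<Longrightarrow> complex_of_real (g z) = p z"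
  shows "g \<in> real_trig_poly"
  using assms by (auto simp: real_trig_poly_def)

text \<open>On the unit circle the inverse is the conjugate, so real and imaginary parts are
  combinations of z_i and its inverse. They are the functions that separate points.\<close>

lemma real_trig_poly_Re_Im:
  "(\<lambda>z. Re (z i)) \<in> real_trig_poly" "(\<lambda>z. Im (z i)) \<in> real_trig_poly"
proof -
  have inv: "inverse (z i) = cnj (z i)" if "z \<in> space torus" for z :: "'a \<Rightarrow> complex"
    using that by (simp add: space_torus inverse_complex_def complex_eq_iff cmod_power2[symmetric])
  have "continuous_on UNIV (\<lambda>z :: 'a \<Rightarrow> complex. z i)" by simp
  then have cont: "continuous_on (space torus) (\<lambda>z :: 'a \<Rightarrow> complex. z i)"
    by (rule continuous_on_subset) simp
  have "(\<lambda>z. 1/2 * (z i + inverse (z i))) \<in> trig_poly"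
    by (intro trig_poly.intros trig_poly_coordinate)
  moreover have "complex_of_real (Re (z i)) = 1/2 * (z i + inverse (z i))"
    if "z \<in> space torus" for z :: "'a \<Rightarrow> complex"
    using inv[OF that] by (simp add: complex_eq_iff)
  ultimately show "(\<lambda>z. Re (z i)) \<in> real_trig_poly"
    by (rule real_trig_polyI[OF continuous_on_Re[OF cont]])
  have "(\<lambda>z. - \<i>/2 * (z i + -1 * inverse (z i))) \<in> trig_poly"
    by (intro trig_poly.intros trig_poly_coordinate)
  moreover have "complex_of_real (Im (z i)) = - \<i>/2 * (z i + -1 * inverse (z i))"
    if "z \<in> space torus" for z :: "'a \<Rightarrow> complex"
    using inv[OF that] by (simp add: complex_eq_iff)
  ultimately show "(\<lambda>z. Im (z i)) \<in> real_trig_poly"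
    by (rule real_trig_polyI[OF continuous_on_Im[OF cont]])
qed

lemma function_ring_real_trig_poly:
  "function_ring_on (real_trig_poly :: (('n::finite \<Rightarrow> complex) \<Rightarrow> real) set) (space torus)"
proof
  show "compact (space (torus :: ('n \<Rightarrow> complex) measure))" by (rule compact_torus)
  show "continuous_on (space torus) f" if "f \<in> real_trig_poly" for f :: "('n \<Rightarrow> complex) \<Rightarrow> real"
    using that by (simp add: real_trig_poly_def)
  fix f g :: "('n \<Rightarrow> complex) \<Rightarrow> real" assume "f \<in> real_trig_poly" "g \<in> real_trig_poly"
  then obtain p q where p: "p \<in> trig_poly" "\<forall>z\<in>space torus. complex_of_real (f z) = p z"
      and q: "q \<in> trig_poly" "\<forall>z\<in>space torus. complex_of_real (g z) = q z"
      and fg: "continuous_on (space torus) f" "continuous_on (space torus) g"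
    by (auto simp: real_trig_poly_def)
  show "(\<lambda>z. f z + g z) \<in> real_trig_poly"
    using p(2) q(2) fg by (auto simp: real_trig_poly_def intro!: continuous_intros bexI[OF _ trig_poly.add[OF p(1) q(1)]])
  obtain r where "r \<in> trig_poly" "\<forall>z\<in>space torus. p z * q z = r z"
    using trig_poly_mult[OF p(1) q(1)] by blast
  then show "(\<lambda>z. f z * g z) \<in> real_trig_poly"
    using p(2) q(2) fg by (auto simp: real_trig_poly_def intro!: continuous_intros bexI[of _ r])
next
  show "(\<lambda>_. c) \<in> real_trig_poly" for c
    by (auto simp: real_trig_poly_def intro!: bexI[OF _ trig_poly_const[of "of_real c"]])
  fix x y :: "'n \<Rightarrow> complex" assume "x \<noteq> y"
  then obtain i where "x i \<noteq> y i" by auto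
  then show "\<exists>f\<in>real_trig_poly. f x \<noteq> f y"
    using real_trig_poly_Re_Im[of i] by (metis (no_types, lifting) complex_eqI)
qed

text \<open>
  X reaches the continuous functions by Stone-Weierstrass, then the indicators of closed sets
  (limits of cut-off distance functions), of Borel sets (Dynkin's \<pi>-\<lambda> theorem), and finally all
  of L^2 through simple functions.
\<close>
lemma l2_monomial_induct:
  fixes X :: "'n::finite l2 set"
  assumes closed: "closed X"
    and monomial: "\<And>m. basis_vec m \<in> X"
    and add: "\<And>f g. f \<in> X \<Longrightarrow> g \<in> X \<Longrightarrow> f + g \<in> X"
    and scale: "\<And>c f. f \<in> X \<Longrightarrow> c *\<^sub>C f \<in> X"
  shows "f \<in> X"
proof -
  have limit: "abs_l2 f \<in> X"
    if "\<And>n. abs_l2 (g n) \<in> X" "\<And>n. g n \<in> borel_measurable torus" "f \<in> borel_measurable torus"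
      "square_integrable w" "\<And>n z. z \<in> space torus \<Longrightarrow> norm (g n z) \<le> norm (w z)"
      "\<And>z. z \<in> space torus \<Longrightarrow> (\<lambda>n. g n z) \<longlonglongrightarrow> f z" for g :: "nat \<Rightarrow> _" and f w
    using closed_sequentially[OF closed that(1) tendsto_abs_l2(3)[OF that(2-6)]] .
  have limit_const: "abs_l2 f \<in> X"
    if "\<And>n. abs_l2 (g n) \<in> X" "\<And>n. g n \<in> borel_measurable torus" "f \<in> borel_measurable torus"
      "\<And>n z. z \<in> space torus \<Longrightarrow> norm (g n z) \<le> B"
      "\<And>z. z \<in> space torus \<Longrightarrow> (\<lambda>n. g n z) \<longlonglongrightarrow> f z" for g :: "nat \<Rightarrow> _" and f and B :: real
  proof (rule limit[of g f "\<lambda>_. of_real B", OF that(1-3)])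
    show "square_integrable (\<lambda>_. of_real B :: complex)" by (rule square_integrable_bounded) auto
    show "norm (g n z) \<le> norm (of_real B :: complex)" if "z \<in> space torus" for n z
      using \<open>\<And>n z. z \<in> space torus \<Longrightarrow> norm (g n z) \<le> B\<close>[OF that, of n] by simp
  qed (use that in auto)
  have poly: "abs_l2 p \<in> X" if "p \<in> trig_poly" for p
    using that
  proof induction
    case (monomial m)
    then show ?case using assms(2)[of m] by (simp add: basis_vec.abs_eq)
  qed (simp_all add: abs_l2_add abs_l2_scale square_integrable_trig_poly assms)
  have cont_meas: "h \<in> borel_measurable torus" if "continuous_on UNIV h" for h :: "('n \<Rightarrow> complex) \<Rightarrow> real"
    using measurable_compose[OF measurable_torus_borel borel_measurable_continuous_onI[OF that]] .
  have cont: "abs_l2 (\<lambda>z. of_real (h z)) \<in> X" if h: "continuous_on UNIV h" for h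
  proof -
    have "continuous_on (space torus) h" using h continuous_on_subset by blast
    then have "\<exists>g\<in>real_trig_poly. \<forall>z\<in>space torus. \<bar>h z - g z\<bar> < 1 / Suc n" for n
      using function_ring_on.Stone_Weierstrass_basic[OF function_ring_real_trig_poly, of h "1 / Suc n"] by simp
    then obtain G where G: "\<And>n. G n \<in> real_trig_poly" "\<And>n z. z \<in> space torus \<Longrightarrow> \<bar>h z - G n z\<bar> < 1 / Suc n"
      by metis
    then have "\<forall>n. \<exists>p\<in>trig_poly. \<forall>z\<in>space torus. complex_of_real (G n z) = p z"
      by (auto simp: real_trig_poly_def)
    then obtain p where p: "\<And>n. p n \<in> trig_poly" "\<And>n z. z \<in> space torus \<Longrightarrow> complex_of_real (G n z) = p n z"
      by metis
    have d: "norm (p n z - of_real (h z)) < 1 / Suc n" if "z \<in> space torus" for n z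
      using G(2)[OF that, of n] p(2)[OF that, of n, symmetric] 
      by (simp add: abs_minus_commute flip: of_real_diff)
    obtain B where B: "\<And>z. z \<in> space torus \<Longrightarrow> \<bar>h z\<bar> \<le> B"
      using compact_imp_bounded[OF compact_continuous_image[OF \<open>continuous_on (space torus) h\<close> compact_torus]]
      by (auto simp: bounded_iff)
    show ?thesis
    proof (rule limit_const[of p])
      show "abs_l2 (p n) \<in> X" for n using poly p by blast
      show "p n \<in> borel_measurable torus" for n
        using square_integrable_trig_poly[OF p(1)] by (simp add: square_integrable_def)
      show "(\<lambda>z. complex_of_real (h z)) \<in> borel_measurable torus"
        by (intro measurable_compose[OF cont_meas[OF h]] borel_measurable_of_real)
      \<comment> \<open>The approximation error is at most 1 for every \<open>n\<close>, so one
        constant dominates the whole sequence.\<close>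
      show "norm (p n z) \<le> B + 1" if z: "z \<in> space torus" for n z
      proof -
        have "norm (p n z) \<le> norm (p n z - of_real (h z)) + norm (of_real (h z) :: complex)"
          by (metis diff_add_cancel norm_triangle_ineq)
        also have "\<dots> \<le> 1 / Suc n + B" using d[OF z, of n] B[OF z] by simp
        also have "1 / Suc n \<le> (1::real)" by simp
        finally show ?thesis by simp
      qed
      show "(\<lambda>n. p n z) \<longlonglongrightarrow> of_real (h z)" if z: "z \<in> space torus" for z
      proof (rule LIM_zero_cancel, rule Lim_null_comparison)
        show "\<forall>\<^sub>F n in sequentially. norm (p n z - of_real (h z)) \<le> 1 / real (Suc n)"
          using d[OF z] by (intro always_eventually allI less_imp_le)
        show "(\<lambda>n. 1 / real (Suc n)) \<longlonglongrightarrow> 0" by (rule LIMSEQ_Suc[OF lim_1_over_n])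
      qed
    qed
  qed
  have ind_meas: "(\<lambda>z. indicator B z :: complex) \<in> borel_measurable torus" if "B \<in> sets borel" for B
    using measurable_compose[OF measurable_torus_borel borel_measurable_indicator[OF that]] .
  have one: "abs_l2 (\<lambda>_. 1) \<in> X" using cont[of "\<lambda>_. 1"] by simp
  have borel: "abs_l2 (indicator B) \<in> X" if "B \<in> sets borel" for B
  proof -
    have B: "B \<in> sigma_sets UNIV (Collect closed)" using that by (simp add: borel_eq_closed)
    have "Int_stable (Collect closed :: ('n \<Rightarrow> complex) set set)" by (auto simp: Int_stable_def)
    moreover have "(Collect closed :: ('n \<Rightarrow> complex) set set) \<subseteq> Pow UNIV" by auto
    ultimately show ?thesis using B
    proof (induction rule: sigma_sets_induct_disjoint)
      case (basic C)
      then have C: "closed C" by simp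
      show ?case
      \<comment> \<open>By convention \<open>infdist z {}\<close> is 0, so for empty
        \<open>C\<close> the cut-offs would be constantly 1 instead of tending to the
        indicator.\<close>
      proof (cases "C = {}")
        case True
        then show ?thesis using cont[of "\<lambda>_. 0"] by simp
      next
        case False
        \<comment> \<open>Equal to 1 on \<open>C\<close> and, for n > 0, equal to 0 at distance at
          least 1/n from it. A point outside the closed set \<open>C\<close> has positive distance,
          so the values there are eventually 0.\<close>
        let ?h = "\<lambda>n z. max 0 (1 - real n * infdist z C)"
        have hc: "continuous_on UNIV (?h n)" for n by (intro continuous_intros)
        show ?thesis
        proof (rule limit_const[of "\<lambda>n z. of_real (?h n z)" _ 1])
          show "abs_l2 (\<lambda>z. complex_of_real (?h n z)) \<in> X" for n by (rule cont[OF hc])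
          show "(\<lambda>z. complex_of_real (?h n z)) \<in> borel_measurable torus" for n
            by (intro measurable_compose[OF cont_meas[OF hc]] borel_measurable_of_real)
          show "(indicator C :: _ \<Rightarrow> complex) \<in> borel_measurable torus" using C by (intro ind_meas) auto
          show "norm (complex_of_real (?h n z)) \<le> 1" for n z by (simp add: infdist_nonneg)
          fix z :: "'n \<Rightarrow> complex"
          show "(\<lambda>n. complex_of_real (?h n z)) \<longlonglongrightarrow> indicator C z"
          proof (cases "z \<in> C")
            case True then show ?thesis by simp
          next
            case False
            then have "infdist z C > 0"
              using C \<open>C \<noteq> {}\<close> in_closed_iff_infdist_zero infdist_nonneg[of z C] by (metis less_eq_real_def)
            then have "eventually (\<lambda>n. 1 / infdist z C < real n) sequentially"
              using eventually_gt_at_top filterlim_real_sequentially by (auto simp: filterlim_at_top_dense)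
            then have "eventually (\<lambda>n. complex_of_real (?h n z) = indicator C z) sequentially"
              by eventually_elim (use False \<open>infdist z C > 0\<close> in \<open>simp add: field_simps max_def\<close>)
            then show ?thesis by (rule tendsto_eventually)
          qed
        qed
      qed
    next
      case empty
      then show ?case using cont[of "\<lambda>_. 0"] by simp
    next
      case (compl A)
      then have A: "A \<in> sets borel" by (simp add: borel_eq_closed)
      have sq: "square_integrable (indicator A)" 
        by (intro square_integrable_indicator ind_meas A)
      have sq1: "square_integrable (\<lambda>_. 1)" by (intro square_integrable_bounded[of _ 1]) auto
      have eq: "indicator (UNIV - A) = (\<lambda>z. (1::complex) + (-1) * indicator A z)" by (auto simp: indicator_def)
      show ?case
        unfolding eq abs_l2_add[OF sq1 square_integrable_scale[OF sq]] abs_l2_scale[OF sq]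
        by (intro add scale one compl(2))
    next
      case (union A)
      then have A: "A i \<in> sets borel" for i by (auto simp: borel_eq_closed)
      have sq: "square_integrable (indicator (A i))" for i
        by (intro square_integrable_indicator ind_meas A)
      \<comment> \<open>By disjointness the indicator of a partial union is a finite sum of
        indicators; the full union is then a limit dominated by 1.\<close>
      have fin: "abs_l2 (indicator (\<Union>i<n. A i)) \<in> X" for n :: nat
      proof (induction n)
        case 0
        then show ?case using cont[of "\<lambda>_. 0"] by simp
      next
        case (Suc n)
        have sq': "square_integrable (indicator (\<Union>i<n. A i))"
          using A by (intro square_integrable_indicator ind_meas) auto
        have "A i \<inter> A n = {}" if "i < n" for i
          using that by (intro disjoint_family_onD[OF union(1)]) auto
        then have "(\<Union>i<n. A i) \<inter> A n = {}" by blast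
        then have "indicator (A n \<union> (\<Union>i<n. A i)) z = indicator (A n) z + (indicator (\<Union>i<n. A i) z :: complex)" for z
          by (auto simp: indicator_def)
        then have "indicator (\<Union>i<Suc n. A i) = (\<lambda>z. indicator (A n) z + (indicator (\<Union>i<n. A i) z :: complex))"
          by (simp add: lessThan_Suc fun_eq_iff)
        then show ?case using abs_l2_add[OF sq sq'] add Suc union(3) by simp
      qed
      show ?case
      proof (rule limit_const[of "\<lambda>n. indicator (\<Union>i<n. A i)" _ 1, OF fin])
        show "(\<lambda>n. indicator (\<Union>i<n. A i) z :: complex) \<longlonglongrightarrow> indicator (\<Union> (range A)) z" for z
          by (rule LIMSEQ_indicator_UN)
        show "(indicator (\<Union>i<n. A i) :: _ \<Rightarrow> complex) \<in> borel_measurable torus" for n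
          using A by (intro ind_meas) auto
        show "(indicator (\<Union> (range A)) :: _ \<Rightarrow> complex) \<in> borel_measurable torus"
          using A by (intro ind_meas) auto
      qed (simp split: split_indicator)
    qed
  qed
  have sq_ind: "square_integrable (indicator A)" if "A \<in> sets torus" for A
    using that by (intro square_integrable_indicator borel_measurable_indicator)
  have ind: "abs_l2 (indicator A) \<in> X" if "A \<in> sets torus" for A
  proof -
    obtain B where B: "B \<in> sets borel" "A = space torus \<inter> B" using sets_torus_subset_borel[OF \<open>A \<in> sets torus\<close>] .
    have "abs_l2 (indicator A) = abs_l2 (indicator B)"
    proof (rule abs_l2_eqI[OF sq_ind[OF that]])
      show "square_integrable (indicator B)"
        by (intro square_integrable_indicator ind_meas B)
      show "AE z in torus. indicator A z = (indicator B z :: complex)"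
        using B(2) by (intro AE_I2) (auto simp: indicator_def)
    qed
    with borel B(1) show ?thesis by simp
  qed
  have simple: "abs_l2 s \<in> X \<and> square_integrable s" if s: "simple_function torus s" for s
  proof -
    define e where "e y = (indicator (s -` {y} \<inter> space torus) :: _ \<Rightarrow> complex)" for y
    have fin: "abs_l2 (\<lambda>z. \<Sum>y\<in>S. y * e y z) \<in> X \<and>
        square_integrable (\<lambda>z. \<Sum>y\<in>S. y * e y z)" if "finite S" for S
      using that
    proof (induction S)
      case empty
      then show ?case using cont[of "\<lambda>_. 0"] by (simp add: square_integrable_zero)
    next
      case (insert y S)
      have "s -` {y} \<inter> space torus \<in> sets torus" using s by (simp add: simple_functionD)
      from ind[OF this, folded e_def] sq_ind[OF this, folded e_def] insert show ?case
        by (simp add: abs_l2_add abs_l2_scale square_integrable_add square_integrable_scale add scale)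
    qed
    have eq: "(\<Sum>y\<in>s ` space torus. y * e y z) = s z" if "z \<in> space torus" for z
      unfolding simple_function_indicator_representation_banach[OF s that] e_def
      by (intro sum.cong refl) (simp split: split_indicator)
    have "finite (s ` space torus)" using s by (simp add: simple_functionD)
    note F = fin[OF this]
    have "bounded (s ` space torus)" using s by (simp add: simple_functionD finite_imp_bounded)
    then obtain B where "\<And>z. z \<in> space torus \<Longrightarrow> norm (s z) \<le> B" by (auto simp: bounded_iff)
    then have "square_integrable s" using s by (intro square_integrable_bounded borel_measurable_simple_function)
    moreover from this have "abs_l2 s = abs_l2 (\<lambda>z. \<Sum>y\<in>s ` space torus. y * e y z)"
      using F eq by (intro abs_l2_eqI AE_I2) auto
    ultimately show ?thesis using F by simp
  qed
  show ?thesis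
  proof (induction f rule: l2.abs_induct)
    case (1 f)
    then have sq: "square_integrable f" by (simp add: l2_eq_refl_iff)
    then have f: "f \<in> borel_measurable torus" by (simp add: square_integrable_def)
    \<comment> \<open>Simple approximations measured from the base point 0 satisfy |F_i| \<le> 2
      |f|, which is why 2 f serves as the dominating function.\<close>
    from borel_measurable_implies_sequence_metric[OF f, of 0] obtain F where
      F: "\<And>i. simple_function torus (F i)" "\<And>z. z \<in> space torus \<Longrightarrow> (\<lambda>i. F i z) \<longlonglongrightarrow> f z"
        "\<And>i z. z \<in> space torus \<Longrightarrow> norm (F i z) \<le> 2 * norm (f z)"
      unfolding dist_0_norm dist_norm diff_zero by blast
    show ?case
    proof (rule limit[of F _ "\<lambda>z. 2 * f z"])
      show "abs_l2 (F n) \<in> X" for n using simple F(1) by blast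
      show "F n \<in> borel_measurable torus" for n using F(1) by (rule borel_measurable_simple_function)
      show "norm (F n z) \<le> norm (2 * f z)" if "z \<in> space torus" for n z
        using F(3)[OF that] by (simp add: norm_mult)
      show "square_integrable (\<lambda>z. 2 * f z)" by (rule square_integrable_scale[OF sq])
    qed (fact f, rule F(2))
  qed
qed

section \<open>Rotations of the torus\<close>

lemma measurable_cis: "cis \<in> borel \<rightarrow>\<^sub>M restrict_space borel (sphere 0 1)"
  by (intro measurable_restrict_space2 borel_measurable_continuous_onI continuous_intros) auto

lemma sets_cis_vimage: "A \<in> sets circle \<Longrightarrow> cis -` A \<in> sets borel"
  using measurable_sets[OF measurable_cis] by (simp add: sets_circle)

lemma emeasure_circle:
  assumes "A \<in> sets circle"
  shows "emeasure circle A = emeasure lborel ({0..<2*pi} \<inter> cis -` A) / ennreal (2*pi)"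
proof -
  have m: "cis \<in> uniform_measure lborel {0..<2 * pi} \<rightarrow>\<^sub>M restrict_space borel (sphere 0 1)"
    using measurable_cis by (simp cong: measurable_cong_sets)
  have A: "A \<in> sets (restrict_space borel (sphere 0 1))" using assms by (simp add: sets_circle)
  show ?thesis
    using A sets_cis_vimage[OF assms] unfolding circle_def
    by (subst emeasure_distr[OF m A]) (simp add: emeasure_uniform_measure)
qed

lemma measurable_circle_rotate:
  assumes "norm c = 1"
  shows "(*) c \<in> circle \<rightarrow>\<^sub>M circle"
proof -
  have "(*) c \<in> restrict_space borel (sphere 0 1) \<rightarrow>\<^sub>M restrict_space borel (sphere 0 1)"
    using assms by (intro measurable_restrict_space3 borel_measurable_continuous_onI continuous_intros)
      (auto simp: norm_mult)
  then show ?thesis by (simp add: sets_circle cong: measurable_cong_sets)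
qed

lemma emeasure_lborel_translate:
  fixes A :: "real set"
  assumes "A \<in> sets borel"
  shows "emeasure lborel ((+) a -` A) = emeasure lborel A"
  using emeasure_distr[of "(+) a" lborel borel A] assms by (simp add: lborel_distr_plus)

text \<open>For c = \<open>cis a\<close> the rotation becomes a translation of angles, which turns
  [0, 2 pi) into [a, 2 pi + a). This interval is cut at 2 pi, and the overhang [2 pi, 2 pi + a) is
  moved back to [0, a) by the periodicity of \<open>cis\<close>.\<close>

lemma emeasure_circle_rotate:
  assumes c: "norm c = 1" and A: "A \<in> sets circle"
  shows "emeasure circle ((*) c -` A \<inter> space circle) = emeasure circle A"
proof -
  obtain a where a: "0 \<le> a" "a < 2 * pi" "c = cis a"
    using c by (metis Arg2pi_eq Arg2pi_ge_0 Arg2pi_lt_2pi cis_conv_exp mult_1 of_real_1)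
  let ?B = "cis -` A" and ?m = "emeasure lborel"
  have B[measurable]: "?B \<in> sets borel" by (rule sets_cis_vimage[OF A])
  have [simp]: "x \<in> sets lborel \<longleftrightarrow> x \<in> sets (borel :: real measure)" for x by simp
  have "?m ({0..<2*pi} \<inter> cis -` ((*) c -` A \<inter> space circle)) = ?m ((+) a -` ({a..<2*pi + a} \<inter> ?B))"
    using a by (intro arg_cong[of _ _ ?m]) (auto simp: space_circle cis_mult)
  also have "\<dots> = ?m ({a..<2*pi + a} \<inter> ?B)"
    by (rule emeasure_lborel_translate) simp
  also have "{a..<2*pi + a} \<inter> ?B = ({a..<2*pi} \<inter> ?B) \<union> ({2*pi..<2*pi + a} \<inter> ?B)"
    using a by auto
  also have "?m \<dots> = ?m ({a..<2*pi} \<inter> ?B) + ?m ({2*pi..<2*pi + a} \<inter> ?B)"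
    by (rule plus_emeasure[symmetric]) auto
  also have "?m ({2*pi..<2*pi + a} \<inter> ?B) = ?m ((+) (2*pi) -` ({2*pi..<2*pi + a} \<inter> ?B))"
    by (rule emeasure_lborel_translate[symmetric]) simp
  also have "(+) (2*pi) -` ({2*pi..<2*pi + a} \<inter> ?B) = {0..<a} \<inter> ?B"
    by (auto simp flip: cis_mult)
  also have "?m ({a..<2*pi} \<inter> ?B) + ?m ({0..<a} \<inter> ?B) = ?m (({a..<2*pi} \<inter> ?B) \<union> ({0..<a} \<inter> ?B))"
    by (rule plus_emeasure) auto
  also have "({a..<2*pi} \<inter> ?B) \<union> ({0..<a} \<inter> ?B) = {0..<2*pi} \<inter> ?B"
    using a by auto
  finally show ?thesis
    by (simp add: emeasure_circle A measurable_sets[OF measurable_circle_rotate[OF c] A])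
qed

section \<open>Invariance of the product measure\<close>

definition rotation :: "complex \<Rightarrow> ('n \<Rightarrow> complex) \<Rightarrow> 'n \<Rightarrow> complex" where
  "rotation c z = (\<lambda>i. c * z i)"

lemma measurable_rotate:
  assumes "norm c = 1"
  shows "rotation c \<in> (torus :: ('n::finite \<Rightarrow> complex) measure) \<rightarrow>\<^sub>M torus"
proof -
  have "(\<lambda>z. (*) c (z i)) \<in> PiM UNIV (\<lambda>_::'n. circle) \<rightarrow>\<^sub>M circle" for i
    by (rule measurable_compose[OF _ measurable_circle_rotate[OF assms]]) simp
  then show ?thesis
    unfolding torus_def rotation_def
    by (intro measurable_PiM_single') (auto simp: space_PiM PiE_def space_circle norm_mult assms)
qed

text \<open>A product measure is determined by its values on boxes; the preimage of a box is again a
  box, and each factor is invariant by \<open>emeasure_circle_rotate\<close>.\<close>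

lemma distr_rotate:
  assumes "norm c = 1"
  shows "distr torus torus (rotation c) = (torus :: ('n::finite \<Rightarrow> complex) measure)"
proof -
  interpret product_prob_space "\<lambda>_::'n. circle" UNIV
    by (simp add: product_prob_space_def product_prob_space_axioms_def product_sigma_finite_def
        prob_space_circle prob_space_imp_sigma_finite)
  show ?thesis
    unfolding torus_def
  proof (rule PiM_eqI)
    fix A :: "'n \<Rightarrow> complex set" assume "\<And>i. i \<in> UNIV \<Longrightarrow> A i \<in> sets circle"
    then have A: "A i \<in> sets circle" for i by simp
    let ?P = "PiM UNIV (\<lambda>_::'n. circle)"
    have "emeasure (distr ?P ?P (rotation c)) (Pi\<^sub>E UNIV A) = emeasure ?P (rotation c -` Pi\<^sub>E UNIV A \<inter> space ?P)"
      using measurable_rotate[OF assms] A unfolding torus_def by (intro emeasure_distr sets_PiM_I_finite) auto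
    also have "rotation c -` Pi\<^sub>E UNIV A \<inter> space ?P = (\<Pi>\<^sub>E i\<in>UNIV. (*) c -` A i \<inter> space circle)"
      by (auto simp: rotation_def space_PiM PiE_def Pi_def)
    also have "emeasure ?P \<dots> = (\<Prod>i\<in>UNIV. emeasure circle ((*) c -` A i \<inter> space circle))"
      by (rule emeasure_PiM) (auto intro: measurable_sets[OF measurable_circle_rotate[OF assms] A])
    also have "\<dots> = (\<Prod>i\<in>UNIV. emeasure circle (A i))"
      by (simp add: emeasure_circle_rotate[OF assms A])
    finally show "emeasure (distr ?P ?P (rotation c)) (Pi\<^sub>E UNIV A) = (\<Prod>i\<in>UNIV. emeasure circle (A i))" .
  qed auto
qed

lemma AE_rotate:
  assumes "norm c = 1" "AE z in torus. P z"
  shows "AE z in torus. P (rotation c z)"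
  using AE_distrD[OF measurable_rotate[OF assms(1)], of P] assms(2)
  unfolding distr_rotate[OF assms(1)] by blast

lemma square_integrable_rotate:
  assumes "norm c = 1" "square_integrable f"
  shows "square_integrable (\<lambda>z. f (rotation c z))"
proof -
  have [measurable]: "f \<in> borel_measurable torus" using assms by (simp add: square_integrable_def)
  have "integrable (distr torus torus (rotation c)) (\<lambda>z. (norm (f z))\<^sup>2)"
    using assms by (simp add: distr_rotate square_integrable_def)
  from integrable_distr[OF measurable_rotate[OF assms(1)] this]
  show ?thesis
    using measurable_compose[OF measurable_rotate[OF assms(1)], of f] by (simp add: square_integrable_def)
qed

lemma l2_norm_rotate:
  assumes "norm c = 1" "square_integrable f"
  shows "l2_norm (\<lambda>z. f (rotation c z)) = l2_norm f"
proof -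
  have [measurable]: "f \<in> borel_measurable torus" using assms by (simp add: square_integrable_def)
  have "(\<integral>z. (norm (f z))\<^sup>2 \<partial>torus) = (\<integral>z. (norm (f z))\<^sup>2 \<partial>distr torus torus (rotation c))"
    by (simp add: distr_rotate assms)
  also have "\<dots> = (\<integral>z. (norm (f (rotation c z)))\<^sup>2 \<partial>torus)"
    by (rule integral_distr[OF measurable_rotate[OF assms(1)]]) measurable
  finally show ?thesis by (simp add: l2_norm_def)
qed

text \<open>The same \<open>c\<close> multiplies every coordinate, so only the total degree enters
  the eigenvalue.\<close>

lemma monomial_rotate: "monomial m (rotation c z) = c powi (\<Sum>i\<in>UNIV. m i) * monomial m z" if "norm c = 1"
proof -
  have "c \<noteq> 0" using that by auto
  then have "(\<Prod>i\<in>A. c powi m i) = c powi (\<Sum>i\<in>A. m i)" for A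
    by (induction A rule: infinite_finite_induct) (auto simp: power_int_add)
  then show ?thesis
    by (simp add: monomial_def rotation_def power_int_mult_distrib prod.distrib)
qed

lemma rotate_inverse:
  assumes "c \<noteq> 0"
  shows "rotation c (rotation (inverse c) z) = z"
  using assms by (simp add: rotation_def flip: mult.assoc)

section \<open>Rotations as operators on L^2\<close>

definition rotate_op :: "complex \<Rightarrow> 'n::finite l2 \<Rightarrow> 'n l2" where
  "rotate_op c f = abs_l2 (\<lambda>z. rep_l2 f (rotation c z))"

text \<open>Independence of the representative: a rotation preserves the measure and hence the null
  sets.\<close>

lemma rotate_op_abs_l2:
  assumes "norm c = 1" "square_integrable f"
  shows "rotate_op c (abs_l2 f) = abs_l2 (\<lambda>z. f (rotation c z))"
proof -
  have *: "l2_eq (rep_l2 (abs_l2 f)) f"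
    using assms(2) by (intro rep_abs_rsp_left[OF Quotient3_l2]) (simp add: l2_eq_def)
  show ?thesis
    unfolding rotate_op_def
    by (intro abs_l2_eqI square_integrable_rotate AE_rotate assms) (use * in \<open>auto simp: l2_eq_def\<close>)
qed

lemma rotate_op_add:
  assumes "norm c = 1"
  shows "rotate_op c (f + g) = rotate_op c f + rotate_op c g"
proof (induction f rule: l2.abs_induct)
  case (1 f)
  show ?case
  proof (induction g rule: l2.abs_induct)
    case (1 g)
    with \<open>l2_eq f f\<close> show ?case
      by (simp add: l2_eq_refl_iff rotate_op_abs_l2[OF assms] square_integrable_add
          square_integrable_rotate[OF assms] flip: abs_l2_add)
  qed
qed

lemma rotate_op_scaleC:
  assumes "norm c = 1"
  shows "rotate_op c (b *\<^sub>C f) = b *\<^sub>C rotate_op c f"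
proof (induction f rule: l2.abs_induct)
  case (1 f)
  then show ?case
    by (simp add: l2_eq_refl_iff rotate_op_abs_l2[OF assms] square_integrable_scale
        square_integrable_rotate[OF assms] flip: abs_l2_scale)
qed

text \<open>Serves twice: as the bound that makes rotations continuous, and as the injectivity by
  which \<phi> = 0 is recovered from the vanishing of its rotate.\<close>

lemma norm_rotate_op:
  assumes "norm c = 1"
  shows "norm (rotate_op c f) = norm f"
proof (induction f rule: l2.abs_induct)
  case (1 f)
  then show ?case
    by (simp add: l2_eq_refl_iff rotate_op_abs_l2[OF assms] norm_l2.abs_eq
        square_integrable_rotate[OF assms] l2_norm_rotate[OF assms])
qed

lemma bounded_linear_rotate_op:
  assumes "norm c = 1"
  shows "bounded_linear (rotate_op c)"
  by (rule bounded_linear_intro[of _ 1])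
    (simp_all add: rotate_op_add rotate_op_scaleC norm_rotate_op scaleR_l2_def assms)

lemma rotate_op_basis_vec:
  assumes "norm c = 1"
  shows "rotate_op c (basis_vec m) = c powi (\<Sum>i\<in>UNIV. m i) *\<^sub>C basis_vec m"
  by (simp add: basis_vec.abs_eq rotate_op_abs_l2 abs_l2_scale[symmetric] square_integrable_monomial
      monomial_rotate assms)

section \<open>V and rotations by roots of unity\<close>

lemma norm_root_of_unity:
  fixes c :: complex
  assumes "c ^ k = 1" "k > 0"
  shows "norm c = 1"
proof (rule power_eq_imp_eq_base)
  show "norm c ^ k = 1 ^ k" using assms(1) by (simp flip: norm_power)
qed (use assms(2) in auto)

text \<open>Stated for every k-th root of unity, since \<open>slant_hankel_kernel\<close> applies it
  to \<open>inverse c\<close>. Both sides are continuous and linear in \<open>f\<close>, so they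
  agree on a closed subspace and \<open>l2_monomial_induct\<close> leaves only the
  monomials.\<close>

lemma V_rotate_op:
  fixes V :: "'n::finite l2 \<Rightarrow> 'n l2"
  assumes V: "is_V k V" and k: "k > 0" and c: "c ^ k = 1"
  shows "V (rotate_op c f) = V f"
proof -
  have nc: "norm c = 1" using norm_root_of_unity[OF c k] .
  have lin: "bounded_linear V" and sc: "V (b *\<^sub>C f) = b *\<^sub>C V f" for b f
    using V by (auto simp: is_V_def bounded_clinear_op_def)
  have "f \<in> {f. V (rotate_op c f) = V f}"
  proof (rule l2_monomial_induct)
    have "continuous_on UNIV V" "continuous_on UNIV (\<lambda>f. V (rotate_op c f))"
      by (intro bounded_linear.continuous_on[OF lin]
          bounded_linear.continuous_on[OF bounded_linear_rotate_op[OF nc]] continuous_on_id)+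
    then show "closed {f. V (rotate_op c f) = V f}" by (intro closed_Collect_eq)
    fix m :: "'n \<Rightarrow> int"
    show "basis_vec m \<in> {f. V (rotate_op c f) = V f}"
    proof (cases "\<forall>i. int k dvd m i")
      case True
      then have "int k dvd (\<Sum>i\<in>UNIV. m i)" by (intro dvd_sum) auto
      then obtain j where "(\<Sum>i\<in>UNIV. m i) = int k * j" ..
      then have "c powi (\<Sum>i\<in>UNIV. m i) = 1" using c by (simp add: power_int_mult)
      moreover have "1 *\<^sub>C basis_vec m = basis_vec m"
        by transfer (simp add: l2_eq_def square_integrable_monomial)
      ultimately show ?thesis by (simp add: rotate_op_basis_vec[OF nc])
    next
      case False
      \<comment> \<open>Whatever the eigenvalue of the rotation is, both sides are multiples of
        \<open>V (basis_vec m)\<close>, which is 0.\<close>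
      moreover have "V (basis_vec m) =
          (if \<forall>i. int k dvd m i then basis_vec (\<lambda>i. - (m i div int k)) else 0)"
        using V unfolding is_V_def by blast
      ultimately have "V (basis_vec m) = 0" by (simp only: if_False)
      moreover have "b *\<^sub>C (0 :: 'n l2) = 0" for b
        by transfer (simp add: l2_eq_def square_integrable_zero)
      ultimately show ?thesis by (simp add: rotate_op_basis_vec[OF nc] sc)
    qed
  qed (simp_all add: rotate_op_add rotate_op_scaleC nc sc linear_add[OF bounded_linear.linear[OF lin]])
  then show ?thesis by simp
qed

section \<open>Slant Hankel operators\<close>

lemma L_infty_rotate:
  assumes "norm c = 1" "\<phi> \<in> L_infty"
  shows "(\<lambda>z. \<phi> (rotation c z)) \<in> L_infty"
proof -
  obtain B where "\<phi> \<in> borel_measurable torus" "AE z in torus. norm (\<phi> z) \<le> B"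
    using assms(2) by (auto simp: L_infty_def)
  then show ?thesis
    using AE_rotate[OF assms(1), of "\<lambda>z. norm (\<phi> z) \<le> B"]
      measurable_compose[OF measurable_rotate[OF assms(1)], of \<phi> borel]
    by (auto simp: L_infty_def)
qed

lemma square_integrable_L_infty_mult:
  assumes "\<phi> \<in> L_infty" "square_integrable f"
  shows "square_integrable (\<lambda>z. \<phi> z * f z)"
  using assms by (auto simp: L_infty_def intro: square_integrable_bounded_mult)

lemma square_integrable_one: "square_integrable (\<lambda>_. 1)"
  by (simp add: square_integrable_def)

text \<open>
  The product of \<phi> with the function below is h - h \<circ> rotation (inverse c), where
  h z = \<phi> z * \<phi> (rotation c z) * a z.
\<close>
lemma slant_hankel_kernel:
  fixes V :: "'n::finite l2 \<Rightarrow> 'n l2"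
  assumes V: "is_V k V" and k: "k > 0" and c: "c ^ k = 1" and \<phi>: "\<phi> \<in> L_infty"
    and a: "square_integrable a"
  defines "f \<equiv> \<lambda>z. \<phi> (rotation c z) * a z - \<phi> (rotation (inverse c) z) * a (rotation (inverse c) z)"
  shows "square_integrable f" "slant_hankel V \<phi> (abs_l2 f) = 0"
proof -
  have nc: "norm c = 1" using norm_root_of_unity[OF c k] .
  then have nd: "norm (inverse c) = 1" and c0: "c \<noteq> 0" by (auto simp: norm_inverse)
  have d: "inverse c ^ k = 1" using c by (simp add: power_inverse)
  define h where "h = (\<lambda>z. \<phi> z * (\<phi> (rotation c z) * a z))"
  have h: "square_integrable h"
    unfolding h_def by (intro square_integrable_L_infty_mult L_infty_rotate nc \<phi> a)
  show f: "square_integrable f"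
    unfolding f_def
    by (intro square_integrable_diff square_integrable_L_infty_mult L_infty_rotate nc nd \<phi> a
        square_integrable_rotate)
  \<comment> \<open>In h(z/c) the two rotations in the middle factor cancel, which leaves \<phi>(z)
    as a common factor of both terms.\<close>
  have "(\<lambda>z. \<phi> z * f z) = (\<lambda>z. h z - h (rotation (inverse c) z))"
    by (simp add: f_def h_def rotate_inverse[OF c0] algebra_simps)
  then have "mult_op \<phi> (abs_l2 f) = abs_l2 h - rotate_op (inverse c) (abs_l2 h)"
    by (simp add: mult_op_abs_l2[OF \<phi> f] rotate_op_abs_l2[OF nd h] abs_l2_diff[OF h square_integrable_rotate[OF nd h]])
  moreover have "linear V" using V by (simp add: is_V_def bounded_clinear_op_def bounded_linear.linear)
  ultimately show "slant_hankel V \<phi> (abs_l2 f) = 0"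
    by (simp add: slant_hankel_def linear_diff V_rotate_op[OF V k d])
qed

theorem theorem3p11:
  fixes k :: nat
    and V :: "'n::finite l2 \<Rightarrow> 'n l2"
    and \<phi> :: "('n \<Rightarrow> complex) \<Rightarrow> complex"
  assumes "k \<ge> 2" and "is_V k V" and "\<phi> \<in> L_infty"
  shows "\<not> isometric_op (slant_hankel V \<phi>)"
proof
  assume iso: "isometric_op (slant_hankel V \<phi>)"
  define c where "c = cis (2 * pi / k)"
  have k: "k > 0" using assms(1) by simp
  have "c ^ k = cis (real k * (2 * pi / k))" unfolding c_def by (rule Complex.DeMoivre)
  then have c: "c ^ k = 1" using k by simp
  have nc: "norm c = 1" by (simp add: c_def)
  then have c0: "c \<noteq> 0" by auto
  have "c \<noteq> 1"
  proof
    assume "c = 1"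
    then have "cos (2 * pi / k) = 1" by (simp add: c_def complex_eq_iff)
    \<comment> \<open>For k \<ge> 2 the angle lies in (0, pi], where the cosine is strictly below
      its value at 0.\<close>
    moreover have "cos (2 * pi / k) < cos 0"
    proof (cases "k = 2")
      case False
      then show ?thesis using assms(1) by (intro cos_monotone_0_pi) (auto simp: field_simps)
    qed simp
    ultimately show False by simp
  qed
  then have ic: "inverse c \<noteq> 1" by simp
  \<comment> \<open>Any coordinate will do; one exists because types are inhabited, which is n \<ge>
    1 here.\<close>
  define i :: 'n where "i = undefined"
  have inj: "f = 0" if "slant_hankel V \<phi> f = 0" for f
    using iso[unfolded isometric_op_def, rule_format, of f] that by simp
  have ker: "AE z in torus. \<phi> (rotation c z) * a z - \<phi> (rotation (inverse c) z) * a (rotation (inverse c) z) = 0"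
    if "square_integrable a" for a
    using inj[OF slant_hankel_kernel(2)[OF assms(2) k c assms(3) that]]
    by (simp only: abs_l2_eq_0_iff[OF slant_hankel_kernel(1)[OF assms(2) k c assms(3) that]])
  have "square_integrable (\<lambda>z. z i)"
    by (rule square_integrable_bounded[of _ 1]) (auto simp: space_torus measurable_coordinate)
  from ker[OF square_integrable_one] ker[OF this]
  have "AE z in torus. \<phi> (rotation c z) = 0"
    using AE_space
  proof eventually_elim
    case (elim z)
    then have "z i \<noteq> 0" by (auto simp: space_torus dest: spec[of _ i])
    \<comment> \<open>The choice a = 1 gives \<phi>(c z) = \<phi>(z/c); substituting this into the
      relation for a = z_i leaves the factor 1 - 1/c.\<close>
    moreover have "\<phi> (rotation c z) * z i * (1 - inverse c) = 0"
      using elim by (simp add: rotation_def algebra_simps)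
    ultimately show ?case using ic by simp
  qed
  moreover have "square_integrable \<phi>"
    using square_integrable_L_infty_mult[OF assms(3) square_integrable_one] by simp
  ultimately have "rotate_op c (abs_l2 \<phi>) = 0"
    by (simp add: rotate_op_abs_l2 nc abs_l2_eq_0_iff square_integrable_rotate)
  then have "abs_l2 \<phi> = 0" using norm_rotate_op[OF nc, of "abs_l2 \<phi>"] by simp
  \<comment> \<open>A vanishing symbol is not yet a contradiction: the operator now kills the
    constant 1, which is nonzero in L^2 of a probability measure.\<close>
  then have "mult_op \<phi> (abs_l2 (\<lambda>_. 1)) = 0"
    by (simp add: mult_op_abs_l2[OF assms(3) square_integrable_one])
  moreover have "linear V"
    using assms(2) by (simp add: is_V_def bounded_clinear_op_def bounded_linear.linear)
  ultimately have "slant_hankel V \<phi> (abs_l2 (\<lambda>_. 1)) = 0"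
    by (simp add: slant_hankel_def linear_0)
  from inj[OF this] have "AE z :: 'n \<Rightarrow> complex in torus. False"
    by (simp add: abs_l2_eq_0_iff square_integrable_one)
  then show False by simp
qed

end
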